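(* Let $E$ be a finite set and let $f:\mathcal{P}(E)\to\mathbb{Z}$ be a submodular function. Let $B_f\subseteq\mathbb{R}^E$ be the base polytope of $f$, and write $\mathrm{cr}(B_f):=\mathrm{cr}(B_f\cap\mathbb{Z}^E)$ for the Carathéodory rank of its set of integer points. Then $$\mathrm{cr}(B_f)=\dim B_f+1 .$$
   Context: For a finite set $E$, $\mathcal{P}(E)$ denotes its power set. A function $f:\mathcal{P}(E)\to\mathbb{Z}$ is called submodular if $f(\emptyset)=0$ and $f(A)+f(B)\geq f(A\cup B)+f(A\cap B)$ for all $A,B\subseteq E$. For $x\in\mathbb{R}^E$ and $U\subseteq E$ write $x(U):=\sum_{e\in U}x(e)$. The base polytope of $f$ is $$B_f=\{x\in\mathbb{R}^E\mid x(U)\leq f(U)\text{ for all }U\subseteq E,\ x(E)=f(E)\}.$$ $\dim B_f$ denotes the dimension of the affine hull of $B_f$. For a finite set $H\subseteq\mathbb{R}^E$, the integer cone generated by $H$ is $$\mathrm{int.cone}(H):=\{\lambda_1x_1+\cdots+\lambda_kx_k\mid x_1,\ldots,x_k\in H,\ \lambda_1,\ldots,\lambda_k\in\mathbb{Z}_{\geq 0}\}.$$ The Carathéodory rank $\mathrm{cr}(H)$ of $H$ is the least integer $t$ such that every element of $\mathrm{int.cone}(H)$ is a nonnegative integer combination of $t$ elements of $H$.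
   Formalization: Equality fails in general (E of two elements, f=1 on singletons, 0 on the empty set and E: cr=1, dim+1=2). Proved: cr(B_f) ≤ dim B_f + 1 for all submodular f on nonempty E, with equality if 0 is not in the affine hull of B_f (e.g. if f(E) ≠ 0); otherwise only the bound. *)

theory Defs
  imports "HOL-Analysis.Analysis"
begin

text \<open>The finite ground set is the whole index type \<open>'e\<close>, and
  \<open>\<real>\<^sup>E\<close> is \<^typ>\<open>real ^ 'e\<close>.\<close>

definition submodular :: "('e::finite set \<Rightarrow> int) \<Rightarrow> bool" where
  "submodular f \<longleftrightarrow> f {} = 0 \<and> (\<forall>A B. f A + f B \<ge> f (A \<union> B) + f (A \<inter> B))"

definition base_polytope :: "('e::finite set \<Rightarrow> int) \<Rightarrow> (real ^ 'e) set" where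
  "base_polytope f =
     {x. (\<forall>U. (\<Sum>e\<in>U. x $ e) \<le> of_int (f U)) \<and> (\<Sum>e\<in>UNIV. x $ e) = of_int (f UNIV)}"

definition integer_points :: "(real ^ 'e::finite) set" where
  "integer_points = {x. \<forall>e. x $ e \<in> \<int>}"

definition int_combinations :: "nat \<Rightarrow> 'v::real_vector set \<Rightarrow> 'v set" where
  "int_combinations t H =
     {(\<Sum>i<t. of_nat (l i) *\<^sub>R x i) | (l :: nat \<Rightarrow> nat) (x :: nat \<Rightarrow> 'v). \<forall>i<t. x i \<in> H}"

definition int_cone :: "'v::real_vector set \<Rightarrow> 'v set" where
  "int_cone H = (\<Union>k. int_combinations k H)"

text \<open>For finite \<open>H\<close> the set of admissible \<open>t\<close> is nonempty (it contains \<^term>\<open>card H\<close>).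
  The empty combination is allowed, so \<open>{}\<close> and \<open>{0}\<close> have rank \<open>0\<close>.\<close>

definition caratheodory_rank :: "'v::real_vector set \<Rightarrow> nat" where
  "caratheodory_rank H = (LEAST t. int_cone H \<subseteq> int_combinations t H)"

text \<open>
  If the origin lies in the affine hull of the base polytope (which forces \<open>f UNIV = 0\<close>),
  its Caratheodory rank can be smaller than its dimension plus one.
  For example, on a ground set of two elements, the function with value \<open>1\<close> on
  the singletons and \<open>0\<close> on the other two sets is submodular. The integer points of
  its base polytope are \<open>(1,-1)\<close>, \<open>(0,0)\<close> and \<open>(-1,1)\<close>, so the dimension is \<open>1\<close>
  and the rank is also \<open>1\<close>.
\<close>

end

theory Submission
  imports Defs
begin

text \<open>The upper bound is proved by induction on the dimension \<open>d\<close> of \<open>B = B\<^sub>f\<close>. Let \<open>w \<in> k B\<close> be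
  integral and let \<open>e\<close> be an element whose coordinate is not constant on \<open>B\<close>. The slices
  \<open>B\<^sub>c = {x \<in> B. x\<^sub>e = c}\<close> with \<open>c\<close> an integer are again base polytopes, of dimension less than \<open>d\<close>.
  If \<open>c < w\<^sub>e / k < c + 1\<close>, then \<open>w \<in> a B\<^sub>c + b B\<^sub>c\<^sub>+\<^sub>1\<close> with \<open>a + b = k\<close>. Choose \<open>u\<close> to be an
  extreme point of the intersection of \<open>a B\<^sub>c\<close> and \<open>w - b B\<^sub>c\<^sub>+\<^sub>1\<close>; it is integral by polymatroid
  intersection. The minimal faces of \<open>B\<^sub>c\<close> at \<open>u / a\<close> and of \<open>B\<^sub>c\<^sub>+\<^sub>1\<close> at \<open>(w - u) / b\<close> are base
  polytopes whose directions meet only in \<open>0\<close> and lie in a space of dimension at most \<open>d - 1\<close>, so by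
  induction \<open>u\<close> and \<open>w - u\<close> together need at most \<open>(d - 1) + 2\<close> points. For the lower bound, the integer
  cone of \<open>d + 1\<close> linearly independent integer points is not covered by finitely many subspaces of
  dimension at most \<open>d\<close>.\<close>

section \<open>Coordinate sums over subsets\<close>

abbreviation mass :: "real ^ 'e \<Rightarrow> 'e::finite set \<Rightarrow> real" where
  "mass x U \<equiv> (\<Sum>e\<in>U. x $ e)"

lemma mass_Un_Int: "mass x (A \<union> B) + mass x (A \<inter> B) = mass x A + mass x B"
  by (simp add: sum.union_inter)

lemma mass_insert: "e \<in> A \<Longrightarrow> mass x A = x $ e + mass x (A - {e})"
  by (simp add: sum.remove)

lemma mass_linear:
  "mass (x + y) U = mass x U + mass y U" "mass (x - y) U = mass x U - mass y U"
  "mass (c *\<^sub>R x) U = c * mass x U"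
  by (simp_all add: sum.distrib sum_subtractf sum_distrib_left)

lemma submodularD:
  assumes "submodular f"
  shows "f {} = 0" "f (A \<union> B) + f (A \<inter> B) \<le> f A + f B"
  using assms by (auto simp: submodular_def)

lemma base_polytopeD:
  assumes "x \<in> base_polytope f"
  shows "mass x U \<le> of_int (f U)" "mass x UNIV = of_int (f UNIV)"
  using assms by (auto simp: base_polytope_def)

subsection \<open>Slices and faces of base polytopes\<close>

text \<open>For \<open>p\<close> in the polytope these are the active constraints; they cut out the
  minimal face containing \<open>p\<close>.\<close>

definition tight_sets :: "('e::finite set \<Rightarrow> int) \<Rightarrow> real ^ 'e \<Rightarrow> 'e set set" where
  "tight_sets f p = {U. mass p U = of_int (f U)}"

text \<open>The witness \<open>g\<close> is the direct sum of the restriction of \<open>f\<close> to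
  \<open>U\<close> and the contraction by \<open>U\<close>. The bound \<open>g \<le> f\<close> is
  recorded so that the construction can be iterated.\<close>

lemma base_polytope_tight_submodular:
  assumes f: "submodular f"
  obtains g where "submodular g" "g \<le> f"
    "base_polytope g = {x \<in> base_polytope f. mass x U = of_int (f U)}"
proof
  define g where "g A = f (A \<inter> U) + f (A \<union> U) - f U" for A
  show "submodular g"
    unfolding submodular_def
  proof (intro conjI allI)
    show "g {} = 0" using submodularD(1)[OF f] by (simp add: g_def)
    fix A B
    have "(A \<inter> U) \<union> (B \<inter> U) = (A \<union> B) \<inter> U" "(A \<inter> U) \<inter> (B \<inter> U) = (A \<inter> B) \<inter> U"
      "(A \<union> U) \<union> (B \<union> U) = (A \<union> B) \<union> U" "(A \<union> U) \<inter> (B \<union> U) = (A \<inter> B) \<union> U"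
      by auto
    then show "g (A \<union> B) + g (A \<inter> B) \<le> g A + g B"
      using submodularD(2)[OF f, of "A \<inter> U" "B \<inter> U"] submodularD(2)[OF f, of "A \<union> U" "B \<union> U"]
      by (simp add: g_def)
  qed
  have g_le: "g A \<le> f A" for A
    using submodularD(2)[OF f, of A U] by (simp add: g_def)
  then show "g \<le> f" by (simp add: le_fun_def)
  \<comment> \<open>Here \<open>g U + g (- U) = g UNIV\<close>, so on \<open>base_polytope g\<close>
    the bounds for \<open>U\<close> and \<open>- U\<close> must both be attained.\<close>
  have gU: "g U = f U" "g UNIV = f UNIV" "g (- U) = f UNIV - f U"
    using submodularD(1)[OF f] by (simp_all add: g_def)
  show "base_polytope g = {x \<in> base_polytope f. mass x U = of_int (f U)}"
  proof (intro equalityI subsetI CollectI conjI)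
    fix x assume x: "x \<in> base_polytope g"
    have "mass x A \<le> of_int (f A)" for A
      using base_polytopeD(1)[OF x, of A] g_le[of A] by linarith
    then show "x \<in> base_polytope f"
      using base_polytopeD(2)[OF x] gU by (simp add: base_polytope_def)
    have "mass x U + mass x (- U) = mass x UNIV"
      using mass_Un_Int[of x U "- U"] by simp
    then show "mass x U = of_int (f U)"
      using base_polytopeD(1)[OF x, of U] base_polytopeD(1)[OF x, of "- U"]
        base_polytopeD(2)[OF x] gU by simp
  next
    fix x assume "x \<in> {x \<in> base_polytope f. mass x U = of_int (f U)}"
    then have x: "x \<in> base_polytope f" and xU: "mass x U = of_int (f U)" by auto
    have "mass x A \<le> of_int (g A)" for A
      using mass_Un_Int[of x A U] xU base_polytopeD(1)[OF x, of "A \<union> U"]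
        base_polytopeD(1)[OF x, of "A \<inter> U"]
      by (simp add: g_def)
    then show "x \<in> base_polytope g"
      using base_polytopeD(2)[OF x] gU by (simp add: base_polytope_def)
  qed
qed

lemma base_polytope_face_submodular:
  assumes f: "submodular f" and p: "p \<in> base_polytope f"
  obtains g where "submodular g"
    "base_polytope g = {x \<in> base_polytope f. \<forall>U\<in>tight_sets f p. mass x U = of_int (f U)}"
proof -
  have "finite T \<Longrightarrow> T \<subseteq> tight_sets f p \<Longrightarrow> \<exists>g. submodular g \<and> g \<le> f \<and>
    base_polytope g = {x \<in> base_polytope f. \<forall>U\<in>T. mass x U = of_int (f U)}" for T
  proof (induction T rule: finite_induct)
    case empty
    then show ?case using f by auto
  next
    case (insert U T)
    then obtain g where g: "submodular g" "g \<le> f"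
      "base_polytope g = {x \<in> base_polytope f. \<forall>U\<in>T. mass x U = of_int (f U)}"
      by auto
    \<comment> \<open>The next step intersects with \<open>mass x U = g U\<close> rather than
      \<open>f U\<close>. Both agree because \<open>p\<close> attains \<open>f U\<close> and still
      lies in \<open>base_polytope g\<close>.\<close>
    have "p \<in> base_polytope g"
      using insert.prems p g(3) by (auto simp: tight_sets_def)
    then have "of_int (f U) \<le> real_of_int (g U)"
      using insert.prems base_polytopeD(1)[of p g U] by (simp add: tight_sets_def)
    then have gU: "g U = f U" using g(2) by (simp add: le_fun_def antisym)
    obtain h where h: "submodular h" "h \<le> g"
      "base_polytope h = {x \<in> base_polytope g. mass x U = of_int (g U)}"
      using base_polytope_tight_submodular[OF g(1)] .
    have "base_polytope h = {x \<in> base_polytope f. \<forall>U\<in>insert U T. mass x U = of_int (f U)}"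
      unfolding h(3) g(3) gU by auto
    then show ?case using h(1,2) g(2) by (blast intro: order_trans)
  qed
  from this[of "tight_sets f p"] show ?thesis using that by auto
qed

text \<open>Capping coordinate \<open>e\<close> at \<open>c\<close> preserves submodularity; the
  slice is then the face of the capped polytope on which \<open>{e}\<close> is tight. The point
  \<open>q\<close> ensures that the slice is nonempty.\<close>

lemma base_polytope_section_submodular:
  assumes f: "submodular f" and q: "q \<in> base_polytope f" "q $ e = of_int c"
  obtains g where "submodular g" "base_polytope g = {x \<in> base_polytope f. x $ e = of_int c}"
proof -
  define h where "h A = (if e \<in> A then min (f A) (f (A - {e}) + c) else f A)" for A
  have h: "submodular h"
    unfolding submodular_def
  proof (intro conjI allI)
    show "h {} = 0" using submodularD(1)[OF f] by (simp add: h_def)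
    fix A B
    \<comment> \<open>The mixed case: the minimum defining \<open>h\<close> is the capped value at
      \<open>A\<close> and the value of \<open>f\<close> at \<open>B\<close>.\<close>
    have cross: "h (A \<union> B) + h (A \<inter> B) \<le> f (A - {e}) + c + f B" if "e \<in> A" for A B
    proof (cases "e \<in> B")
      case True
      then have "(A - {e}) \<union> B = A \<union> B" "(A - {e}) \<inter> B = A \<inter> B - {e}" using that by auto
      then show ?thesis using True that submodularD(2)[OF f, of "A - {e}" B] by (auto simp: h_def)
    next
      case False
      then have "(A - {e}) \<union> B = A \<union> B - {e}" "(A - {e}) \<inter> B = A \<inter> B" using that by auto
      then show ?thesis using False that submodularD(2)[OF f, of "A - {e}" B] by (auto simp: h_def)
    qed
    have le: "h A \<le> f A" for A by (simp add: h_def)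
    have "h (A \<union> B) + h (A \<inter> B) \<le> f A + f B"
      using submodularD(2)[OF f, of A B] le[of "A \<union> B"] le[of "A \<inter> B"] by linarith
    moreover have "h (A \<union> B) + h (A \<inter> B) \<le> f (A - {e}) + c + (f (B - {e}) + c)"
      if "e \<in> A" "e \<in> B"
    proof -
      have "(A - {e}) \<union> (B - {e}) = A \<union> B - {e}" "(A - {e}) \<inter> (B - {e}) = A \<inter> B - {e}"
        by auto
      then show ?thesis
        using submodularD(2)[OF f, of "A - {e}" "B - {e}"] that by (simp add: h_def)
    qed
    ultimately show "h (A \<union> B) + h (A \<inter> B) \<le> h A + h B"
      using cross[of A B] cross[of B A]
      by (auto simp: h_def[of A] h_def[of B] min_def Un_commute Int_commute)
  qed
  \<comment> \<open>The existence of \<open>q\<close> shows that the cap does not lower the total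
    value and that \<open>c\<close> does not exceed \<open>f {e}\<close>.\<close>
  have "real_of_int (f (UNIV - {e})) + c \<ge> f UNIV"
    using mass_insert[of e UNIV q] base_polytopeD(1)[OF q(1), of "UNIV - {e}"]
      base_polytopeD(2)[OF q(1)] q(2) by simp
  then have hU: "h UNIV = f UNIV" by (simp add: h_def)
  have "c \<le> f {e}" using base_polytopeD(1)[OF q(1), of "{e}"] q(2) by simp
  then have he: "h {e} = c" using submodularD(1)[OF f] by (simp add: h_def)
  have h_iff: "x \<in> base_polytope h \<longleftrightarrow> x \<in> base_polytope f \<and> x $ e \<le> of_int c" for x
  proof
    assume x: "x \<in> base_polytope h"
    have "mass x A \<le> of_int (f A)" for A
      using base_polytopeD(1)[OF x, of A] by (auto simp: h_def split: if_splits)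
    then show "x \<in> base_polytope f \<and> x $ e \<le> of_int c"
      using base_polytopeD(2)[OF x] base_polytopeD(1)[OF x, of "{e}"] hU he
      by (simp add: base_polytope_def)
  next
    assume x: "x \<in> base_polytope f \<and> x $ e \<le> of_int c"
    have "mass x A \<le> of_int (h A)" for A
      using base_polytopeD(1)[of x f A] base_polytopeD(1)[of x f "A - {e}"] x mass_insert[of e A x]
      by (auto simp: h_def min_def)
    then show "x \<in> base_polytope h"
      using base_polytopeD(2)[of x f] x hU by (simp add: base_polytope_def)
  qed
  obtain g where "submodular g" "g \<le> h"
    "base_polytope g = {x \<in> base_polytope h. mass x {e} = of_int (h {e})}"
    using base_polytope_tight_submodular[OF h] .
  moreover have "{x \<in> base_polytope h. mass x {e} = of_int (h {e})}
      = {x \<in> base_polytope f. x $ e = of_int c}"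
    using h_iff he by fastforce
  ultimately show ?thesis using that by simp
qed

subsection \<open>Integrality from two rings of sets\<close>

text \<open>A ring in the lattice sense: closed under union and intersection, with no closure under
  difference.\<close>

definition set_ring :: "'e set set \<Rightarrow> bool" where
  "set_ring T \<longleftrightarrow> {} \<in> T \<and> UNIV \<in> T \<and> (\<forall>A\<in>T. \<forall>B\<in>T. A \<union> B \<in> T \<and> A \<inter> B \<in> T)"

lemma set_ring_Union:
  assumes "set_ring T" "finite S" "S \<subseteq> T"
  shows "\<Union>S \<in> T"
  using assms(2,3) by (induction S rule: finite_induct) (use assms(1) in \<open>auto simp: set_ring_def\<close>)

lemma set_ring_Inter:
  assumes "set_ring T" "finite S" "S \<subseteq> T"
  shows "\<Inter>S \<in> T"
  using assms(2,3) by (induction S rule: finite_induct) (use assms(1) in \<open>auto simp: set_ring_def\<close>)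

text \<open>Uncrossing: \<open>mass p\<close> is modular and \<open>f\<close> submodular, so the
  slacks at \<open>A \<union> B\<close> and \<open>A \<inter> B\<close> are nonnegative with sum at
  most zero.\<close>

lemma set_ring_tight_sets:
  assumes f: "submodular f" and p: "p \<in> base_polytope f"
  shows "set_ring (tight_sets f p)"
  unfolding set_ring_def
proof (intro conjI ballI)
  show "{} \<in> tight_sets f p" using submodularD(1)[OF f] by (simp add: tight_sets_def)
  show "UNIV \<in> tight_sets f p" using base_polytopeD(2)[OF p] by (simp add: tight_sets_def)
  fix A B assume "A \<in> tight_sets f p" "B \<in> tight_sets f p"
  moreover have "real_of_int (f (A \<union> B)) + of_int (f (A \<inter> B)) \<le> of_int (f A) + of_int (f B)"
    using submodularD(2)[OF f, of A B] by linarith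
  ultimately show "A \<union> B \<in> tight_sets f p" "A \<inter> B \<in> tight_sets f p"
    using mass_Un_Int[of p A B] base_polytopeD(1)[OF p, of "A \<union> B"]
      base_polytopeD(1)[OF p, of "A \<inter> B"]
    by (auto simp: tight_sets_def)
qed

text \<open>The class of \<open>e\<close> under indistinguishability by members of \<open>T\<close>;
  these classes partition the ground set.\<close>

definition atom :: "'e set set \<Rightarrow> 'e \<Rightarrow> 'e set" where
  "atom T e = {e'. \<forall>U\<in>T. e' \<in> U \<longleftrightarrow> e \<in> U}"

lemma atom_self: "e \<in> atom T e"
  by (simp add: atom_def)

lemma atom_eq_iff: "atom T e' = atom T e \<longleftrightarrow> e' \<in> atom T e"
  by (auto simp: atom_def)

text \<open>There is a smallest member containing \<open>e\<close> and a largest member avoiding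
  \<open>e\<close>. Removing the second from the first leaves the elements that no member separates
  from \<open>e\<close>.\<close>

lemma atom_eq_Diff:
  fixes T :: "'e::finite set set"
  assumes "set_ring T"
  obtains D D' where "D \<in> T" "D' \<in> T" "D' \<subseteq> D" "atom T e = D - D'"
proof
  let ?D = "\<Inter>{U \<in> T. e \<in> U}" and ?V = "\<Union>{U \<in> T. e \<notin> U}"
  show D: "?D \<in> T" using assms by (intro set_ring_Inter) auto
  moreover have "?V \<in> T" using assms by (intro set_ring_Union) auto
  ultimately show "?D \<inter> ?V \<in> T" using assms unfolding set_ring_def by blast
  show "?D \<inter> ?V \<subseteq> ?D" by blast
  show "atom T e = ?D - ?D \<inter> ?V" by (auto simp: atom_def)
qed

lemma mass_atom_Ints:
  assumes "set_ring T" "\<And>U. U \<in> T \<Longrightarrow> mass u U \<in> \<int>"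
  shows "mass u (atom T e) \<in> \<int>"
proof -
  obtain D D' where D: "D \<in> T" "D' \<in> T" "D' \<subseteq> D" "atom T e = D - D'"
    using atom_eq_Diff[OF assms(1)] .
  then have "mass u (atom T e) = mass u D - mass u D'" by (simp add: sum_diff)
  then show ?thesis using assms(2) D by simp
qed

text \<open>Every member of \<open>T\<close> is a disjoint union of atoms.\<close>

lemma mass_eq_0_of_atoms:
  assumes "\<And>e. mass z (atom T e) = 0" "U \<in> T"
  shows "mass z U = 0"
proof -
  have "mass z U = (\<Sum>A\<in>atom T ` U. mass z {e \<in> U. atom T e = A})"
    by (rule sum.image_gen) simp
  also have "\<dots> = 0"
  proof (rule sum.neutral, rule ballI)
    fix A assume "A \<in> atom T ` U"
    then obtain e where e: "e \<in> U" "A = atom T e" by auto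
    then have "{e' \<in> U. atom T e' = A} = A"
      using assms(2) by (auto simp: atom_eq_iff) (auto simp: atom_def)
    then show "mass z {e' \<in> U. atom T e' = A} = 0" using assms(1) e by simp
  qed
  finally show ?thesis .
qed

section \<open>Balanced vectors and fractional coordinates\<close>

definition indicator_vec :: "'e::finite set \<Rightarrow> real ^ 'e" where
  "indicator_vec A = (\<chi> e. if e \<in> A then 1 else 0)"

lemma inner_indicator_vec: "z \<bullet> indicator_vec A = mass z A"
  by (simp add: indicator_vec_def inner_vec_def if_distrib[of "\<lambda>c. _ * c"] sum.If_cases cong: if_cong)

lemma indicator_vec_Union:
  assumes "pairwise disjnt K"
  shows "(\<Sum>A\<in>K. indicator_vec A) = indicator_vec (\<Union>K)"
proof (rule vec_eq_iff[THEN iffD2], rule allI)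
  fix e
  show "(\<Sum>A\<in>K. indicator_vec A) $ e = indicator_vec (\<Union>K) $ e"
  proof (cases "\<exists>A\<in>K. e \<in> A")
    case True
    then obtain A where A: "A \<in> K" "e \<in> A" by auto
    then have "e \<notin> B" if "B \<in> K - {A}" for B
      using assms that by (auto simp: pairwise_def disjnt_def)
    then have "(\<Sum>B\<in>K - {A}. indicator_vec B $ e) = 0"
      by (intro sum.neutral) (auto simp: indicator_vec_def)
    then show ?thesis using A by (subst sum_component, subst sum.remove[of K A]) (auto simp: indicator_vec_def)
  next
    case False
    then show ?thesis by (auto simp: indicator_vec_def intro!: sum.neutral)
  qed
qed

lemma dim_supported: "dim {x :: real ^ 'e::finite. \<forall>e. e \<notin> F \<longrightarrow> x $ e = 0} = card F"
  using dim_substandard_cart[where 'a = real, of F] by (simp add: dim_vec_eq)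

lemma subspace_supported: "subspace {x :: real ^ 'e::finite. \<forall>e. e \<notin> F \<longrightarrow> x $ e = 0}"
  by (simp add: subspace_def)

text \<open>The members of two partitions of \<open>F\<close> are the nodes of a bipartite multigraph with edge set
  \<open>F\<close>. All degrees are at least two, so there is a cycle; here it is found by
  counting dimensions.\<close>

lemma ex_balanced_vec:
  fixes F :: "'e::finite set"
  assumes F: "F \<noteq> {}"
    and part: "\<And>K. K \<in> {K1, K2} \<Longrightarrow> pairwise disjnt K \<and> \<Union>K = F \<and> (\<forall>A\<in>K. 2 \<le> card A)"
  obtains z where "z \<noteq> 0" "\<And>e. e \<notin> F \<Longrightarrow> z $ e = 0" "\<And>A. A \<in> K1 \<union> K2 \<Longrightarrow> mass z A = 0"
proof -
  have card: "2 * card K \<le> card F" if "K \<in> {K1, K2}" for K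
  proof -
    have "2 * card K = (\<Sum>A\<in>K. 2)" by simp
    also have "\<dots> \<le> (\<Sum>A\<in>K. card A)" using part[OF that] by (intro sum_mono) auto
    also have "\<dots> = card (\<Union>K)"
      using part[OF that] by (subst card_Union_disjoint) (auto simp: pairwise_def)
    finally show ?thesis using part[OF that] by simp
  qed
  let ?V = "{x :: real ^ 'e. \<forall>e. e \<notin> F \<longrightarrow> x $ e = 0}"
  \<comment> \<open>The indicators of each partition sum to that of \<open>F\<close>, so one of them
    depends linearly on all the others. Dropping \<open>A0\<close> leaves at most
    \<open>card F - 1\<close> generators.\<close>
  obtain A0 where A0: "A0 \<in> K1" using part[of K1] F by auto
  define S where "S = indicator_vec ` (K1 - {A0}) \<union> indicator_vec ` K2"
  have sub: "A \<subseteq> F" if "A \<in> K1 \<union> K2" for A using that part by blast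
  have "indicator_vec A \<in> ?V" if "A \<in> K1 \<union> K2" for A
    using sub[OF that] by (auto simp: indicator_vec_def)
  then have "S \<subseteq> ?V" unfolding S_def by blast
  then have spanS: "span S \<subseteq> ?V" by (intro span_minimal subspace_supported)
  have dimS: "dim S < card F"
  proof -
    have "dim S \<le> card S" by (rule dim_le_card') (simp add: S_def)
    also have "\<dots> \<le> card (indicator_vec ` (K1 - {A0})) + card (indicator_vec ` K2)"
      unfolding S_def by (rule card_Un_le)
    also have "\<dots> \<le> card (K1 - {A0}) + card K2"
      by (intro add_mono card_image_le) auto
    also have "\<dots> < card K1 + card K2"
      using card_Diff1_less[OF finite A0] by simp
    finally show ?thesis using card[of K1] card[of K2] by simp
  qed
  have "span S \<noteq> ?V"
  proof
    assume "span S = ?V"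
    then have "dim (span S) = card F" by (simp only: dim_supported)
    then show False using dimS by simp
  qed
  moreover have "span ?V = ?V" by (intro span_eq_iff[THEN iffD2] subspace_supported)
  \<comment> \<open>Among the vectors supported on \<open>F\<close> the span is proper, so a nonzero
    \<open>z\<close> is orthogonal to it; orthogonality to an indicator means vanishing
    mass.\<close>
  ultimately have "span S \<subset> span ?V" using spanS by blast
  from orthogonal_to_subspace_exists_gen[OF this] obtain z where
    z: "z \<noteq> 0" "z \<in> span ?V" "\<And>y. y \<in> span S \<Longrightarrow> orthogonal z y" by blast
  have "(\<Sum>A\<in>K1. indicator_vec A) = (\<Sum>A\<in>K2. indicator_vec A)"
    using part by (simp add: indicator_vec_Union)
  then have "indicator_vec A0
      = (\<Sum>A\<in>K2. indicator_vec A) - (\<Sum>A\<in>K1 - {A0}. indicator_vec A)"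
    using A0 by (simp add: sum.remove[of K1 A0] eq_diff_eq)
  also have "\<dots> \<in> span S"
    by (intro span_diff span_sum) (auto simp: S_def intro: span_base)
  finally have "indicator_vec A0 \<in> span S" .
  then have "indicator_vec A \<in> span S" if "A \<in> K1 \<union> K2" for A
    using that by (cases "A = A0") (auto simp: S_def intro: span_base)
  then have "mass z A = 0" if "A \<in> K1 \<union> K2" for A
    using z(3) that by (simp add: orthogonal_def flip: inner_indicator_vec)
  then show ?thesis using that z \<open>span ?V = ?V\<close> by auto
qed

text \<open>Suppose that the set \<open>F\<close> of fractional coordinates is nonempty. Atoms have
  integral mass, so one that meets \<open>F\<close> meets it at least twice. A balanced vector on
  the traces of the atoms on \<open>F\<close> then has mass zero on all members of both rings,
  against uniqueness.\<close>

lemma integer_point_of_set_rings: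
  fixes u :: "real ^ 'e::finite"
  assumes ring: "set_ring T1" "set_ring T2"
    and int: "\<And>U. U \<in> T1 \<union> T2 \<Longrightarrow> mass u U \<in> \<int>"
    and unique: "\<And>z. (\<And>U. U \<in> T1 \<union> T2 \<Longrightarrow> mass z U = 0) \<Longrightarrow> z = 0"
  shows "u \<in> integer_points"
proof (rule ccontr)
  define F where "F = {e. u $ e \<notin> \<int>}"
  assume "u \<notin> integer_points"
  then have F: "F \<noteq> {}" by (auto simp: F_def integer_points_def)
  define K where "K T = (\<lambda>e. atom T e \<inter> F) ` F" for T :: "'e set set"
  have disj: "pairwise disjnt (K T)" for T
    unfolding pairwise_def
  proof (intro ballI impI)
    fix A B assume "A \<in> K T" "B \<in> K T" "A \<noteq> B"
    then obtain a b where ab: "A = atom T a \<inter> F" "B = atom T b \<inter> F" by (auto simp: K_def)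
    show "disjnt A B"
    proof (rule ccontr)
      assume "\<not> disjnt A B"
      then obtain x where "x \<in> atom T a" "x \<in> atom T b" using ab by (auto simp: disjnt_def)
      then have "atom T a = atom T b" by (simp flip: atom_eq_iff)
      then show False using ab \<open>A \<noteq> B\<close> by simp
    qed
  qed
  have un: "\<Union>(K T) = F" for T using atom_self[of _ T] by (auto simp: K_def)
  have card: "2 \<le> card A" if T: "T \<in> {T1, T2}" and A: "A \<in> K T" for T A
  proof (rule ccontr)
    assume small: "\<not> 2 \<le> card A"
    obtain e where e: "e \<in> F" "A = atom T e \<inter> F" using A by (auto simp: K_def)
    then have "e \<in> A" using atom_self[of e T] by simp
    moreover from this have "card A \<noteq> 0" by auto
    ultimately have "card A = 1" using small by linarith
    then have "A = {e}" using \<open>e \<in> A\<close> by (auto simp: card_1_singleton_iff)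
    \<comment> \<open>A single fractional coordinate would be the difference of the integral mass of
      its atom and a sum of integers.\<close>
    then have "atom T e - {e} \<subseteq> - F" using e by auto
    then have "mass u (atom T e - {e}) \<in> \<int>" by (intro Ints_sum) (auto simp: F_def)
    moreover have "mass u (atom T e) \<in> \<int>"
      using T ring int by (intro mass_atom_Ints) auto
    ultimately have "u $ e \<in> \<int>"
      using mass_insert[OF atom_self[of e T], of u] by (metis Ints_diff add_diff_cancel_right')
    then show False using e by (simp add: F_def)
  qed
  have "pairwise disjnt L \<and> \<Union>L = F \<and> (\<forall>A\<in>L. 2 \<le> card A)" if "L \<in> {K T1, K T2}" for L
    using disj un card that by blast
  then obtain z where z: "z \<noteq> 0" "\<And>e. e \<notin> F \<Longrightarrow> z $ e = 0"
    "\<And>A. A \<in> K T1 \<union> K T2 \<Longrightarrow> mass z A = 0"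
    using ex_balanced_vec[OF F, of "K T1" "K T2"] by metis
  have "mass z (atom T e) = 0" if T: "T \<in> {T1, T2}" for T e
  proof -
    have "mass z (atom T e) = mass z (atom T e \<inter> F)"
      using z(2) by (intro sum.mono_neutral_right) auto
    also have "\<dots> = 0"
    proof (cases "atom T e \<inter> F = {}")
      case False
      then obtain e' where "e' \<in> F" "atom T e' = atom T e" by (auto simp: atom_eq_iff)
      then have "atom T e \<inter> F \<in> K T" by (auto simp: K_def)
      then show ?thesis using z(3) T by auto
    qed (metis sum.empty)
    finally show ?thesis .
  qed
  then have "mass z U = 0" if "U \<in> T1 \<union> T2" for U
    using that mass_eq_0_of_atoms[of z T1 U] mass_eq_0_of_atoms[of z T2 U] by auto
  then show False using unique z(1) by blast
qed

subsection \<open>Extreme points of polymatroid intersections\<close>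

lemma convex_base_polytope: "convex (base_polytope f)"
  unfolding convex_def
proof (intro ballI allI impI)
  fix x y and u v :: real
  assume x: "x \<in> base_polytope f" and y: "y \<in> base_polytope f" and uv: "0 \<le> u" "0 \<le> v" "u + v = 1"
  have "mass (u *\<^sub>R x + v *\<^sub>R y) U \<le> of_int (f U)" for U
    using base_polytopeD(1)[OF x, of U] base_polytopeD(1)[OF y, of U] uv
    unfolding mass_linear by (intro convex_bound_le)
  moreover have "mass (u *\<^sub>R x + v *\<^sub>R y) UNIV = of_int (f UNIV)"
    using base_polytopeD(2)[OF x] base_polytopeD(2)[OF y] uv
    unfolding mass_linear by (simp flip: distrib_right)
  ultimately show "u *\<^sub>R x + v *\<^sub>R y \<in> base_polytope f" by (simp add: base_polytope_def)
qed

lemma compact_base_polytope: "compact (base_polytope f)"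
  unfolding compact_eq_bounded_closed
proof
  \<comment> \<open>The lower bound subtracts the constraint for the complement of \<open>e\<close>
    from the fixed total.\<close>
  have lb: "of_int (f UNIV - f (UNIV - {e})) \<le> x $ e" and ub: "x $ e \<le> of_int (f {e})"
    if x: "x \<in> base_polytope f" for x e
    using base_polytopeD(1)[OF x, of "{e}"] base_polytopeD(1)[OF x, of "UNIV - {e}"]
      base_polytopeD(2)[OF x] mass_insert[of e UNIV x] by simp_all
  show "bounded (base_polytope f)"
  proof (rule boundedI)
    fix x assume x: "x \<in> base_polytope f"
    have "norm x \<le> (\<Sum>e\<in>UNIV. \<bar>x $ e\<bar>)" by (rule norm_le_l1_cart)
    also have "\<dots> \<le> (\<Sum>e\<in>UNIV. \<bar>of_int (f UNIV - f (UNIV - {e}))\<bar> + \<bar>of_int (f {e})\<bar>)"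
    proof (rule sum_mono)
      fix e
      show "\<bar>x $ e\<bar> \<le> \<bar>of_int (f UNIV - f (UNIV - {e}))\<bar> + \<bar>of_int (f {e})\<bar>"
        using lb[OF x, of e] ub[OF x, of e] by linarith
    qed
    finally show "norm x \<le> (\<Sum>e\<in>UNIV. \<bar>of_int (f UNIV - f (UNIV - {e}))\<bar> + \<bar>of_int (f {e})\<bar>)" .
  qed
  have "base_polytope f = (\<Inter>U. {x. mass x U \<le> of_int (f U)}) \<inter> {x. mass x UNIV = of_int (f UNIV)}"
    by (auto simp: base_polytope_def)
  also have "closed \<dots>"
    by (intro closed_Int closed_INT ballI closed_Collect_le closed_Collect_eq continuous_intros)
  finally show "closed (base_polytope f)" .
qed

text \<open>Moving along \<open>z\<close> leaves tight constraints unchanged, and the finitely many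
  others have positive slack.\<close>

lemma base_polytope_perturb:
  assumes p: "p \<in> base_polytope f" and z: "\<And>U. U \<in> tight_sets f p \<Longrightarrow> mass z U = 0"
  shows "\<exists>d>0. \<forall>t. \<bar>t\<bar> < d \<longrightarrow> p + t *\<^sub>R z \<in> base_polytope f"
proof -
  have "\<forall>\<^sub>F t in nhds 0. mass (p + t *\<^sub>R z) U \<le> of_int (f U)" for U
  proof (cases "U \<in> tight_sets f p")
    case True
    then show ?thesis
      using z[OF True] unfolding mass_linear by (simp add: tight_sets_def)
  next
    case False
    have "((\<lambda>t. mass p U + t * mass z U) \<longlongrightarrow> mass p U + 0 * mass z U) (nhds 0)"
      by (intro tendsto_intros filterlim_ident)
    moreover have "mass p U < of_int (f U)"
      using False base_polytopeD(1)[OF p, of U] by (auto simp: tight_sets_def)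
    ultimately have "\<forall>\<^sub>F t in nhds 0. mass p U + t * mass z U < of_int (f U)"
      by (intro order_tendstoD(2)) auto
    then show ?thesis unfolding mass_linear by (rule eventually_mono) simp
  qed
  then have "\<forall>\<^sub>F t in nhds 0. \<forall>U. mass (p + t *\<^sub>R z) U \<le> of_int (f U)"
    by (rule eventually_all_finite)
  moreover have "mass z UNIV = 0"
    using z base_polytopeD(2)[OF p] by (simp add: tight_sets_def)
  then have "mass (p + t *\<^sub>R z) UNIV = of_int (f UNIV)" for t
    using base_polytopeD(2)[OF p] unfolding mass_linear by simp
  ultimately have "\<forall>\<^sub>F t in nhds 0. p + t *\<^sub>R z \<in> base_polytope f"
    by (simp add: base_polytope_def)
  then show ?thesis by (simp add: eventually_nhds_metric)
qed

lemma extreme_point_of_symmetric: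
  fixes x :: "'a::euclidean_space"
  assumes "x extreme_point_of S" "x + z \<in> S" "x - z \<in> S"
  shows "z = 0"
proof (rule ccontr)
  assume "z \<noteq> 0"
  have "x - z \<noteq> x + z"
  proof
    assume "x - z = x + z"
    then have "2 *\<^sub>R z = 0" by (metis add.right_inverse add_left_cancel diff_conv_add_uminus scaleR_2)
    then show False using \<open>z \<noteq> 0\<close> by simp
  qed
  then have "midpoint (x - z) (x + z) \<in> open_segment (x - z) (x + z)" by auto
  moreover have "midpoint (x - z) (x + z) = x"
    by (simp add: midpoint_def flip: scaleR_2)
  ultimately show False using assms by (auto simp: extreme_point_of_def)
qed

text \<open>At an extreme point of the intersection of \<open>a B\<^sub>f\<close> and \<open>w - b B\<^sub>g\<close> the minimal faces have
  complementary directions, and the point is integral (Edmonds' polymatroid intersection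
  theorem).\<close>

lemma ex_integer_split:
  fixes f g :: "'e::finite set \<Rightarrow> int" and a b :: nat
  assumes f: "submodular f" and g: "submodular g" and ab: "0 < a" "0 < b"
    and pq: "p \<in> base_polytope f" "q \<in> base_polytope g"
      "real a *\<^sub>R p + real b *\<^sub>R q \<in> integer_points"
  obtains p' q' where "p' \<in> base_polytope f" "q' \<in> base_polytope g"
    "real a *\<^sub>R p' + real b *\<^sub>R q' = real a *\<^sub>R p + real b *\<^sub>R q"
    "real a *\<^sub>R p' \<in> integer_points" "real b *\<^sub>R q' \<in> integer_points"
    "\<And>z. (\<And>U. U \<in> tight_sets f p' \<union> tight_sets g q' \<Longrightarrow> mass z U = 0) \<Longrightarrow> z = 0"
proof -
  define w where "w = real a *\<^sub>R p + real b *\<^sub>R q"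
  have w: "w $ e \<in> \<int>" for e using pq(3) by (simp add: w_def[symmetric] integer_points_def)
  \<comment> \<open>The second set is \<open>w - b B_g\<close>, written as a translate of a scaling
    so that compactness and convexity carry over.\<close>
  define Q where "Q = (\<lambda>x. real a *\<^sub>R x) ` base_polytope f \<inter> (+) w ` (\<lambda>x. (- real b) *\<^sub>R x) ` base_polytope g"
  have "compact Q" unfolding Q_def
    by (intro compact_Int compact_scaling compact_continuous_image compact_base_polytope continuous_intros)
  moreover have "convex Q" unfolding Q_def
    by (intro convex_Int convex_scaling convex_translation convex_base_polytope)
  moreover have "real a *\<^sub>R p \<in> Q"
    unfolding Q_def image_image using pq by (auto simp: w_def)
  ultimately obtain u where u: "u extreme_point_of Q" using extreme_point_exists_convex[of Q] by blast
  then have "u \<in> Q" by (simp add: extreme_point_of_def)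
  then obtain p' where p': "p' \<in> base_polytope f" "u = real a *\<^sub>R p'"
    unfolding Q_def by blast
  obtain q' where q': "q' \<in> base_polytope g" "u = w - real b *\<^sub>R q'"
    using \<open>u \<in> Q\<close> unfolding Q_def by auto
  have unique: "z = 0" if z: "\<And>U. U \<in> tight_sets f p' \<union> tight_sets g q' \<Longrightarrow> mass z U = 0" for z
  proof -
    obtain d1 where d1: "d1 > 0" "\<And>t. \<bar>t\<bar> < d1 \<Longrightarrow> p' + t *\<^sub>R z \<in> base_polytope f"
      using base_polytope_perturb[OF p'(1), of z] z by blast
    obtain d2 where d2: "d2 > 0" "\<And>t. \<bar>t\<bar> < d2 \<Longrightarrow> q' + t *\<^sub>R z \<in> base_polytope g"
      using base_polytope_perturb[OF q'(1), of z] z by blast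
    \<comment> \<open>A shift of \<open>u\<close> by \<open>t\<close> along \<open>z\<close> moves
      \<open>p'\<close> by \<open>t / a\<close> and \<open>q'\<close> by \<open>- t / b\<close>;
      this size keeps both points feasible for \<open>t = s\<close> and
      \<open>t = - s\<close>.\<close>
    define s where "s = min (d1 * a) (d2 * b) / 2"
    have "0 < d1 * a" "0 < d2 * b" using d1(1) d2(1) ab by simp_all
    then have "0 < s" "s < d1 * a" "s < d2 * b" by (auto simp: s_def)
    then have s: "0 < s" "s / a < d1" "s / b < d2" using ab by (simp_all add: divide_less_eq)
    have "u + t *\<^sub>R z \<in> Q" if t: "\<bar>t\<bar> = s" for t
    proof -
      have "p' + (t / a) *\<^sub>R z \<in> base_polytope f"
        using s t by (intro d1(2)) (simp add: abs_divide)
      moreover have "u + t *\<^sub>R z = real a *\<^sub>R (p' + (t / a) *\<^sub>R z)"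
        using ab p'(2) by (simp add: algebra_simps)
      ultimately have "u + t *\<^sub>R z \<in> (\<lambda>x. real a *\<^sub>R x) ` base_polytope f" by blast
      moreover have "q' + (- t / b) *\<^sub>R z \<in> base_polytope g"
        using s t by (intro d2(2)) (simp add: abs_divide)
      moreover have "u + t *\<^sub>R z = w + (- real b) *\<^sub>R (q' + (- t / b) *\<^sub>R z)"
        using ab q'(2) by (simp add: algebra_simps)
      ultimately show ?thesis unfolding Q_def by blast
    qed
    from this[of s] this[of "- s"] have "s *\<^sub>R z = 0"
      using s(1) by (intro extreme_point_of_symmetric[OF u]) auto
    then show "z = 0" using s(1) by simp
  qed
  have "mass u U \<in> \<int>" if "U \<in> tight_sets f p' \<union> tight_sets g q'" for U
  proof (cases "U \<in> tight_sets f p'")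
    case True
    then have "mass u U = real a * of_int (f U)" unfolding p'(2) mass_linear by (simp add: tight_sets_def)
    then show ?thesis by simp
  next
    case False
    then have "mass u U = mass w U - real b * of_int (g U)"
      using that unfolding q'(2) mass_linear by (simp add: tight_sets_def)
    moreover have "mass w U \<in> \<int>" using w by (intro Ints_sum)
    ultimately show ?thesis by simp
  qed
  then have ui: "u \<in> integer_points"
    using unique
    by (rule integer_point_of_set_rings[OF set_ring_tight_sets[OF f p'(1)] set_ring_tight_sets[OF g q'(1)]])
  have "real b *\<^sub>R q' = w - u" using q'(2) by simp
  then have "real b *\<^sub>R q' \<in> integer_points" using ui w by (simp add: integer_points_def)
  then show ?thesis
    using p' q' ui unique by (intro that[of p' q']) (auto simp: w_def[symmetric] algebra_simps)
qed

text \<open>The integrality criterion is applied with both rings equal to the tight sets of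
  \<open>p\<close>; a nonzero \<open>z\<close> vanishing on them would move \<open>p\<close> both
  ways inside the polytope.\<close>

lemma extreme_point_of_base_polytope:
  assumes f: "submodular f" and p: "p extreme_point_of base_polytope f"
  shows "p \<in> integer_points"
proof -
  have pB: "p \<in> base_polytope f" using p by (simp add: extreme_point_of_def)
  note ring = set_ring_tight_sets[OF f pB]
  have "z = 0" if z: "\<And>U. U \<in> tight_sets f p \<Longrightarrow> mass z U = 0" for z
  proof -
    obtain d where d: "d > 0" "\<And>t. \<bar>t\<bar> < d \<Longrightarrow> p + t *\<^sub>R z \<in> base_polytope f"
      using base_polytope_perturb[OF pB z] by blast
    have "(d / 2) *\<^sub>R z = 0"
      using d(1) d(2)[of "d / 2"] d(2)[of "- (d / 2)"]
      by (intro extreme_point_of_symmetric[OF p]) simp_all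
    then show "z = 0" using d(1) by simp
  qed
  then show ?thesis
    by (intro integer_point_of_set_rings[OF ring ring]) (auto simp: tight_sets_def)
qed

lemma base_polytope_integral:
  assumes "submodular f"
  shows "convex hull (base_polytope f \<inter> integer_points) = base_polytope f"
proof
  show "convex hull (base_polytope f \<inter> integer_points) \<subseteq> base_polytope f"
    by (intro hull_minimal convex_base_polytope) auto
  have "base_polytope f = convex hull {x. x extreme_point_of base_polytope f}"
    by (intro Krein_Milman_Minkowski compact_base_polytope convex_base_polytope)
  also have "\<dots> \<subseteq> convex hull (base_polytope f \<inter> integer_points)"
    using extreme_point_of_base_polytope[OF assms]
    by (intro hull_mono) (auto simp: extreme_point_of_def)
  finally show "base_polytope f \<subseteq> convex hull (base_polytope f \<inter> integer_points)" .
qed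

section \<open>Splitting a point between consecutive integer slices\<close>

lemma convex_component_le: "convex {x :: real ^ 'e::finite. x $ e \<le> c}"
  using convex_halfspace_le[where a = "axis e 1" and b = c]
  by (simp add: cart_eq_inner_axis inner_commute)

lemma convex_component_ge: "convex {x :: real ^ 'e::finite. x $ e \<ge> c}"
  using convex_halfspace_ge[where a = "axis e 1" and b = c]
  by (simp add: cart_eq_inner_axis inner_commute)

text \<open>No integer point has its coordinate \<open>e\<close> strictly between \<open>c\<close>
  and \<open>c + 1\<close>. By integrality \<open>p\<close> lies on a segment from the side at most
  \<open>c\<close> to the side at least \<open>c + 1\<close>, and this segment crosses both
  slices.\<close>

lemma ex_component_split:
  assumes f: "submodular f" and p: "p \<in> base_polytope f" "of_int c < p $ e" "p $ e < of_int c + 1"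
  obtains q r where "q \<in> base_polytope f" "r \<in> base_polytope f"
    "q $ e = of_int c" "r $ e = of_int (c + 1)"
    "p = (1 - (p $ e - of_int c)) *\<^sub>R q + (p $ e - of_int c) *\<^sub>R r"
proof -
  let ?H = "base_polytope f \<inter> integer_points"
  define A where "A = {x \<in> ?H. x $ e \<le> of_int c}"
  define B where "B = {x \<in> ?H. x $ e \<ge> of_int c + 1}"
  have "?H = A \<union> B"
  proof -
    have "y \<le> of_int c \<or> y \<ge> of_int c + 1" if "y \<in> \<int>" for y :: real
    proof -
      from that obtain i where "y = of_int i" by (rule Ints_cases)
      moreover have "i \<le> c \<or> c + 1 \<le> i" by linarith
      ultimately show ?thesis by (metis of_int_1 of_int_add of_int_le_iff)
    qed
    then show ?thesis by (auto simp: A_def B_def integer_points_def)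
  qed
  then have pAB: "p \<in> convex hull (A \<union> B)" using base_polytope_integral[OF f] p(1) by simp
  have hA: "convex hull A \<subseteq> {x. x $ e \<le> of_int c}"
    by (intro hull_minimal convex_component_le) (auto simp: A_def)
  have hB: "convex hull B \<subseteq> {x. x $ e \<ge> of_int c + 1}"
    by (intro hull_minimal convex_component_ge) (auto simp: B_def)
  have "A \<union> B \<subseteq> convex hull A \<union> convex hull B"
    using hull_subset[of A convex] hull_subset[of B convex] by blast
  then have pAB': "p \<in> convex hull (convex hull A \<union> convex hull B)"
    using pAB hull_mono by blast
  have "A \<noteq> {}" "B \<noteq> {}" using pAB hA hB p by auto
  then have "convex hull (convex hull A \<union> convex hull B) =
      {u *\<^sub>R x + v *\<^sub>R y | u v x y. 0 \<le> u \<and> 0 \<le> v \<and> u + v = 1 \<and> x \<in> convex hull A \<and> y \<in> convex hull B}"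
    by (intro convex_hull_union_two) auto
  then obtain u v x y where uv: "0 \<le> u" "0 \<le> v" "u + v = 1" and xy: "x \<in> convex hull A" "y \<in> convex hull B"
    and pxy: "p = u *\<^sub>R x + v *\<^sub>R y"
    using pAB' by auto
  have xyB: "x \<in> base_polytope f" "y \<in> base_polytope f"
    using xy hull_mono[of A ?H convex] hull_mono[of B ?H convex] base_polytope_integral[OF f]
    by (auto simp: A_def B_def)
  have le: "x $ e \<le> of_int c" "of_int c + 1 \<le> y $ e" using hA hB xy by auto
  define D where "D = y - x"
  define s where "s = p $ e - of_int c"
  have De: "0 < D $ e" using le by (simp add: D_def)
  have pD: "p = x + v *\<^sub>R D" using pxy uv(3) by (simp add: D_def algebra_simps flip: scaleR_add_left)
  then have pe: "p $ e = x $ e + v * D $ e" by simp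
  have seg: "x + t *\<^sub>R D \<in> base_polytope f" if "0 \<le> t" "t \<le> 1" for t
    using convexD_alt[OF convex_base_polytope xyB that] by (simp add: D_def algebra_simps)
  \<comment> \<open>From \<open>p = x + v *\<^sub>R D\<close>, going back by
    \<open>s / D $ e\<close> reaches coordinate \<open>c\<close>, and going forward by
    \<open>(1 - s) / D $ e\<close> reaches \<open>c + 1\<close>.\<close>
  define q where "q = x + (v - s / D $ e) *\<^sub>R D"
  define r where "r = x + (v + (1 - s) / D $ e) *\<^sub>R D"
  \<comment> \<open>These inequalities place both new parameters in the interval from 0 to
    1.\<close>
  have "s \<le> v * D $ e" "v * D $ e + (1 - s) \<le> D $ e" "0 < s" "s < 1"
    using le p(2,3) pe by (auto simp: s_def D_def)
  then have "q \<in> base_polytope f" "r \<in> base_polytope f"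
    unfolding q_def r_def using uv De by (auto intro!: seg simp: field_simps)
  moreover have "q $ e = of_int c" "r $ e = of_int (c + 1)"
    using De pe by (simp_all add: q_def r_def s_def field_simps)
  moreover have "p = (1 - s) *\<^sub>R q + s *\<^sub>R r"
    unfolding pD q_def r_def by (simp add: algebra_simps flip: scaleR_add_left)
  ultimately show ?thesis using that by (simp add: s_def)
qed

subsection \<open>The upper bound\<close>

lemma int_combinationsI: "(\<And>i. i < t \<Longrightarrow> x i \<in> H) \<Longrightarrow> (\<Sum>i<t. of_nat (l i) *\<^sub>R x i) \<in> int_combinations t H"
  unfolding int_combinations_def by blast

lemma int_combinations_mono: "H \<subseteq> H' \<Longrightarrow> int_combinations t H \<subseteq> int_combinations t H'"
  unfolding int_combinations_def by blast

lemma sum_lessThan_add: "(\<Sum>i<s + t. h i) = (\<Sum>i<s. h i) + (\<Sum>i<t. h (s + i))"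
  for s t :: nat and h :: "nat \<Rightarrow> 'a::comm_monoid_add"
  by (induction t) (simp_all add: add.assoc)

lemma int_combinations_add:
  assumes "x \<in> int_combinations s H" "y \<in> int_combinations t H"
  shows "x + y \<in> int_combinations (s + t) H"
proof -
  obtain l u where x: "x = (\<Sum>i<s. of_nat (l i) *\<^sub>R u i)" "\<forall>i<s. u i \<in> H"
    using assms(1) unfolding int_combinations_def by blast
  obtain m v where y: "y = (\<Sum>i<t. of_nat (m i) *\<^sub>R v i)" "\<forall>i<t. v i \<in> H"
    using assms(2) unfolding int_combinations_def by blast
  have "x + y = (\<Sum>i<s + t. of_nat (if i < s then l i else m (i - s)) *\<^sub>R (if i < s then u i else v (i - s)))"
    unfolding sum_lessThan_add x(1) y(1) by (intro arg_cong2[of _ _ _ _ "(+)"] sum.cong) auto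
  also have "\<dots> \<in> int_combinations (s + t) H"
    using x(2) y(2) by (intro int_combinationsI) auto
  finally show ?thesis .
qed

lemma int_combinations_single: "h \<in> H \<Longrightarrow> of_nat k *\<^sub>R h \<in> int_combinations (Suc 0) H"
  using int_combinationsI[of "Suc 0" "\<lambda>_. h" H "\<lambda>_. k"] by simp

lemma zero_in_int_combinations:
  assumes "H \<noteq> {}"
  shows "0 \<in> int_combinations t H"
proof -
  obtain h where "h \<in> H" using assms by blast
  then show ?thesis using int_combinationsI[of t "\<lambda>_. h" H "\<lambda>_. 0"] by simp
qed

text \<open>Spare slots get coefficient zero but must still hold an element, hence
  \<open>H \<noteq> {}\<close>.\<close>

lemma int_combinations_le:
  assumes "x \<in> int_combinations s H" "H \<noteq> {}" "s \<le> t"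
  shows "x \<in> int_combinations t H"
  using int_combinations_add[OF assms(1) zero_in_int_combinations[OF assms(2), of "t - s"]] assms(3)
  by simp

text \<open>Both direction spaces lie in the directions of \<open>P\<close> with
  \<open>z $ e = 0\<close>, a proper subspace because coordinate \<open>e\<close> varies on
  \<open>P\<close>. They meet only in 0, so their dimensions add up. The strictness pays for the
  extra point needed when two faces are used.\<close>

lemma aff_dim_section_less:
  fixes P :: "(real ^ 'e::finite) set"
  assumes FP: "F1 \<subseteq> P" "F2 \<subseteq> P" and q: "q \<in> F1" and r: "r \<in> F2"
    and const: "\<And>x. x \<in> F1 \<Longrightarrow> x $ e = q $ e" "\<And>x. x \<in> F2 \<Longrightarrow> x $ e = r $ e"
    and y: "y1 \<in> P" "y2 \<in> P" "y1 $ e \<noteq> y2 $ e"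
    and disj: "span ((\<lambda>x. x - q) ` F1) \<inter> span ((\<lambda>x. x - r) ` F2) \<subseteq> {0}"
  shows "aff_dim F1 + aff_dim F2 < aff_dim P"
proof -
  let ?V = "span ((\<lambda>x. x - q) ` P)"
  let ?V1 = "span ((\<lambda>x. x - q) ` F1)" and ?V2 = "span ((\<lambda>x. x - r) ` F2)"
  let ?Z = "{z :: real ^ 'e. z $ e = 0}"
  have Z: "subspace ?Z" by (simp add: subspace_def)
  have V: "x - x' \<in> ?V" if "x \<in> P" "x' \<in> P" for x x'
  proof -
    have "(x - q) - (x' - q) \<in> ?V" using that by (intro span_diff span_base imageI)
    then show ?thesis by simp
  qed
  have VZ: "x - a \<in> ?V \<inter> ?Z" if "x \<in> P" "a \<in> P" "x $ e = a $ e" for x a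
    using V that by simp
  have "(\<lambda>x. x - q) ` F1 \<subseteq> ?V \<inter> ?Z"
    using FP q const(1) by (intro image_subsetI VZ) blast+
  then have "?V1 \<subseteq> ?V \<inter> ?Z"
    by (intro span_minimal subspace_inter subspace_span Z)
  moreover have "(\<lambda>x. x - r) ` F2 \<subseteq> ?V \<inter> ?Z"
    using FP r const(2) by (intro image_subsetI VZ) blast+
  then have "?V2 \<subseteq> ?V \<inter> ?Z"
    by (intro span_minimal subspace_inter subspace_span Z)
  ultimately have "{x + y |x y. x \<in> ?V1 \<and> y \<in> ?V2} \<subseteq> ?V \<inter> ?Z"
    using subspace_add[OF subspace_inter[OF subspace_span Z]] by blast
  then have "dim {x + y |x y. x \<in> ?V1 \<and> y \<in> ?V2} \<le> dim (?V \<inter> ?Z)" by (rule dim_subset)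
  moreover have "dim {x + y |x y. x \<in> ?V1 \<and> y \<in> ?V2} + dim (?V1 \<inter> ?V2) = dim ?V1 + dim ?V2"
    by (intro dim_sums_Int subspace_span)
  moreover have "dim (?V1 \<inter> ?V2) = 0" using disj by simp
  moreover have "dim (?V \<inter> ?Z) < dim ?V"
  proof (rule dim_psubset)
    have "y1 - y2 \<in> ?V" "y1 - y2 \<notin> ?Z" using V y by auto
    then have "?V \<inter> ?Z \<subset> ?V" by blast
    moreover have "span (?V \<inter> ?Z) = ?V \<inter> ?Z"
      by (intro span_eq_iff[THEN iffD2] subspace_inter subspace_span Z)
    ultimately show "span (?V \<inter> ?Z) \<subset> span ?V" by (simp only: span_span)
  qed
  ultimately have "dim ?V1 + dim ?V2 < dim ?V" by linarith
  moreover have "aff_dim F1 = int (dim ?V1)" "aff_dim F2 = int (dim ?V2)" "aff_dim P = int (dim ?V)"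
    using q r FP by (auto simp: dim_span intro!: aff_dim_eq_dim_subtract hull_inc)
  ultimately show ?thesis by simp
qed

text \<open>Carries the uniqueness statement about tight sets over to the direction spaces of
  minimal faces.\<close>

lemma face_tangent:
  assumes "F = {x \<in> base_polytope f. \<forall>U\<in>tight_sets f p. mass x U = of_int (f U)}"
    and "z \<in> span ((\<lambda>x. x - p) ` F)" "U \<in> tight_sets f p"
  shows "mass z U = 0"
proof -
  have "subspace {z. mass z U = 0}"
    by (simp add: subspace_def sum.distrib flip: sum_distrib_left)
  moreover have "mass (x - p) U = 0" if "x \<in> F" for x
    using that assms(1,3) unfolding mass_linear by (simp add: tight_sets_def)
  then have "(\<lambda>x. x - p) ` F \<subseteq> {z. mass z U = 0}" by blast
  ultimately have "span ((\<lambda>x. x - p) ` F) \<subseteq> {z. mass z U = 0}" by (simp add: span_minimal)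
  then show ?thesis using assms(2) by blast
qed

text \<open>The bound \<open>t\<close> is any number above the dimension, and \<open>f\<close>,
  \<open>p\<close>, \<open>k\<close> vary, so strong induction applies to two faces with separate
  budgets.\<close>

lemma base_polytope_int_combinations:
  fixes f :: "'e::finite set \<Rightarrow> int"
  assumes "submodular f" "p \<in> base_polytope f" "real k *\<^sub>R p \<in> integer_points"
    and "aff_dim (base_polytope f) < int t"
  shows "real k *\<^sub>R p \<in> int_combinations t (base_polytope f \<inter> integer_points)"
  using assms
proof (induction t arbitrary: f p k rule: less_induct)
  case (less t f p k)
  note f = less.prems(1) and p = less.prems(2)
  let ?P = "base_polytope f"
  let ?w = "real k *\<^sub>R p"
  have ne: "?P \<inter> integer_points \<noteq> {}"
    using base_polytope_integral[OF f] p by (metis convex_hull_empty empty_iff)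
  have "aff_dim ?P \<ge> 0" using p by (metis aff_dim_negative_iff empty_iff not_less)
  then have t: "0 < t" using less.prems(4) by linarith
  show ?case
  proof (cases "k = 0")
    case True
    then show ?thesis using zero_in_int_combinations[OF ne] by simp
  next
    case k: False
    show ?thesis
    proof (cases "?P = {p}")
      case True
      then have "p \<in> integer_points" using ne by auto
      then have "?w \<in> int_combinations (Suc 0) (?P \<inter> integer_points)"
        using int_combinations_single p by blast
      then show ?thesis using int_combinations_le[OF _ ne] t by simp
    next
      case False
      then obtain x where "x \<in> ?P" "x \<noteq> p" using p by blast
      then obtain e where xe: "x \<in> ?P" "x $ e \<noteq> p $ e" by (auto simp: vec_eq_iff)
      obtain m :: int where m: "real k * p $ e = of_int m"
        using less.prems(3) by (auto simp: integer_points_def elim: Ints_cases)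
      \<comment> \<open>Division with remainder: \<open>c\<close> is the floor of
        \<open>p $ e\<close> and \<open>b / k\<close> its fractional part, so \<open>b\<close>
        becomes the integer weight of the upper slice.\<close>
      define c where "c = m div int k"
      define b where "b = nat (m mod int k)"
      have b: "int b = m mod int k" "b < k" using k by (auto simp: b_def nat_less_iff)
      have mcb: "m = c * int k + int b" unfolding b(1) c_def by simp
      have pe: "p $ e = of_int c + real b / real k"
        using m k unfolding mcb by (simp add: field_simps)
      show ?thesis
      proof (cases "b = 0")
        case True
        then have "p $ e = of_int c" using pe by simp
        then obtain g where g: "submodular g" "base_polytope g = {x \<in> ?P. x $ e = of_int c}"
          using base_polytope_section_submodular[OF f p] by blast
        have pg: "p \<in> base_polytope g" using g(2) p \<open>p $ e = of_int c\<close> by simp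
        \<comment> \<open>With the singleton, of dimension 0, as second face this says that the
          slice has smaller dimension.\<close>
        have "aff_dim (base_polytope g) + aff_dim {p} < aff_dim ?P"
          using g(2) p pg xe by (intro aff_dim_section_less[where q = p and r = p and e = e and ?y1.0 = x and ?y2.0 = p])
             simp_all
        then have "?w \<in> int_combinations (t - 1) (base_polytope g \<inter> integer_points)"
          using g(1) pg less.prems t by (intro less.IH) auto
        then have "?w \<in> int_combinations (t - 1) (?P \<inter> integer_points)"
          using int_combinations_mono[of "base_polytope g \<inter> integer_points" "?P \<inter> integer_points"] g(2)
          by auto
        then show ?thesis using int_combinations_le[OF _ ne] by simp
      next
        case b0: False
        define s where "s = p $ e - of_int c"
        have s: "s = real b / real k" "0 < s" "s < 1" using pe b b0 k by (auto simp: s_def)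
        obtain q r where qr: "q \<in> ?P" "r \<in> ?P" "q $ e = of_int c" "r $ e = of_int (c + 1)"
          "p = (1 - s) *\<^sub>R q + s *\<^sub>R r"
          using ex_component_split[OF f p, of c e] s by (auto simp: s_def)
        obtain g where g: "submodular g" "base_polytope g = {x \<in> ?P. x $ e = of_int c}"
          using base_polytope_section_submodular[OF f qr(1,3)] .
        obtain h where h: "submodular h" "base_polytope h = {x \<in> ?P. x $ e = of_int (c + 1)}"
          using base_polytope_section_submodular[OF f qr(2,4)] .
        have "real k * (1 - s) = real (k - b)" "real k * s = real b"
          using b k by (simp_all add: s(1) algebra_simps of_nat_diff)
        then have w: "?w = real (k - b) *\<^sub>R q + real b *\<^sub>R r"
          by (simp add: qr(5) scaleR_add_right)
        have pos: "0 < k - b" "0 < b" using b b0 by auto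
        have qr': "q \<in> base_polytope g" "r \<in> base_polytope h" using qr g h by auto
        obtain q' r' where q'r': "q' \<in> base_polytope g" "r' \<in> base_polytope h"
          "real (k - b) *\<^sub>R q' + real b *\<^sub>R r' = ?w"
          "real (k - b) *\<^sub>R q' \<in> integer_points" "real b *\<^sub>R r' \<in> integer_points"
          and unique: "\<And>z. (\<And>U. U \<in> tight_sets g q' \<union> tight_sets h r' \<Longrightarrow> mass z U = 0) \<Longrightarrow> z = 0"
          using ex_integer_split[OF g(1) h(1) pos qr'] less.prems(3) unfolding w by metis
        obtain g' where g': "submodular g'"
          "base_polytope g' = {x \<in> base_polytope g. \<forall>U\<in>tight_sets g q'. mass x U = of_int (g U)}"
          using base_polytope_face_submodular[OF g(1) q'r'(1)] .
        obtain h' where h': "submodular h'"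
          "base_polytope h' = {x \<in> base_polytope h. \<forall>U\<in>tight_sets h r'. mass x U = of_int (h U)}"
          using base_polytope_face_submodular[OF h(1) q'r'(2)] .
        have q': "q' \<in> base_polytope g'" and r': "r' \<in> base_polytope h'"
          using q'r' g'(2) h'(2) by (auto simp: tight_sets_def)
        have sub: "base_polytope g' \<subseteq> ?P" "base_polytope h' \<subseteq> ?P"
          using g(2) g'(2) h(2) h'(2) by auto
        have "span ((\<lambda>x. x - q') ` base_polytope g') \<inter> span ((\<lambda>x. x - r') ` base_polytope h') \<subseteq> {0}"
          using face_tangent[OF g'(2)] face_tangent[OF h'(2)] unique by blast
        then have dim: "aff_dim (base_polytope g') + aff_dim (base_polytope h') < aff_dim ?P"
          using q' r' q'r' sub g(2) g'(2) h(2) h'(2) p xe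
          by (intro aff_dim_section_less[where q = q' and r = r' and e = e and ?y1.0 = x and ?y2.0 = p]) auto
        \<comment> \<open>Each face gets its dimension plus one. The dimensions are nonnegative and
          sum to less than that of the polytope, so both budgets are below \<open>t\<close> and
          together at most \<open>t\<close>.\<close>
        define t1 where "t1 = nat (aff_dim (base_polytope g') + 1)"
        define t2 where "t2 = nat (aff_dim (base_polytope h') + 1)"
        have "0 \<le> aff_dim (base_polytope g')" "0 \<le> aff_dim (base_polytope h')"
          using q' r' by (metis aff_dim_negative_iff empty_iff not_less)+
        then have t12: "aff_dim (base_polytope g') < int t1" "aff_dim (base_polytope h') < int t2"
          "t1 < t" "t2 < t" "t1 + t2 \<le> t"
          using dim less.prems(4) by (auto simp: t1_def t2_def)
        have "real (k - b) *\<^sub>R q' \<in> int_combinations t1 (?P \<inter> integer_points)"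
          using less.IH[OF t12(3) g'(1) q' q'r'(4) t12(1)]
            int_combinations_mono[OF Int_mono[OF sub(1) order_refl]] by blast
        moreover have "real b *\<^sub>R r' \<in> int_combinations t2 (?P \<inter> integer_points)"
          using less.IH[OF t12(4) h'(1) r' q'r'(5) t12(2)]
            int_combinations_mono[OF Int_mono[OF sub(2) order_refl]] by blast
        ultimately have "?w \<in> int_combinations (t1 + t2) (?P \<inter> integer_points)"
          using int_combinations_add q'r'(3) by metis
        then show ?thesis using int_combinations_le[OF _ ne] t12(5) by blast
      qed
    qed
  qed
qed

subsection \<open>The lower bound\<close>

text \<open>Points \<open>\<Sum>\<^sub>i m\<^sup>i b\<^sub>i\<close> of the moment curve lie in the integer cone; infinitely many of them
  would lie in the span of the same \<open>t\<close> elements, which meets the curve in finitely many points.\<close>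

lemma independent_card_le:
  fixes H :: "'a::euclidean_space set"
  assumes H: "finite H" and sub: "int_cone H \<subseteq> int_combinations t H"
    and B: "B \<subseteq> H" "independent B"
  shows "card B \<le> t"
proof (rule ccontr)
  assume "\<not> card B \<le> t"
  then obtain n where n: "card B = Suc n" "t \<le> n" by (cases "card B") auto
  have "finite B" using H B(1) finite_subset by blast
  then obtain b where b: "bij_betw b {..<Suc n} B"
    using ex_bij_betw_nat_finite[of B] n(1) by (auto simp: lessThan_atLeast0)
  define v where "v m = (\<Sum>i<Suc n. of_nat (m ^ i) *\<^sub>R b i)" for m
  define \<S> where "\<S> = {S. S \<subseteq> H \<and> card S \<le> t}"
  have "v m \<in> int_combinations (Suc n) H" for m
    unfolding v_def using b B(1) by (intro int_combinationsI) (auto simp: bij_betw_def)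
  then have v: "v m \<in> int_combinations t H" for m
    using sub by (auto simp: int_cone_def)
  have "\<forall>m\<in>UNIV. \<exists>S\<in>\<S>. v m \<in> span S"
  proof
    fix m
    obtain l x where x: "v m = (\<Sum>i<t. of_nat (l i) *\<^sub>R x i)" "\<forall>i<t. x i \<in> H"
      using v[of m] unfolding int_combinations_def by blast
    have "x ` {..<t} \<in> \<S>" using x(2) card_image_le[of "{..<t}" x] by (auto simp: \<S>_def)
    moreover have "v m \<in> span (x ` {..<t})"
      unfolding x(1) by (intro span_sum span_scale span_base) auto
    ultimately show "\<exists>S\<in>\<S>. v m \<in> span S" by blast
  qed
  moreover have "finite \<S>" using H by (simp add: \<S>_def)
  ultimately obtain S where S: "S \<in> \<S>" "infinite {m \<in> UNIV. v m \<in> span S}"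
    using pigeonhole_infinite_rel[of "UNIV :: nat set" \<S> "\<lambda>m S. v m \<in> span S"] infinite_UNIV_nat
    by blast
  have "finite S" "card S \<le> t" using S(1) H finite_subset by (auto simp: \<S>_def)
  have "\<not> B \<subseteq> span S"
  proof
    assume "B \<subseteq> span S"
    then have "dim B \<le> card S" using \<open>finite S\<close> by (rule dim_le_card)
    then show False using dim_eq_card_independent[OF B(2)] n \<open>card S \<le> t\<close> by simp
  qed
  then obtain y where "y \<in> b ` {..<Suc n}" "y \<notin> span S"
    using b by (auto simp only: bij_betw_def)
  then obtain j where j: "j \<le> n" "b j \<notin> span S" by (auto simp: less_Suc_eq_le)
  \<comment> \<open>For \<open>z\<close>, the part of \<open>b j\<close> orthogonal to
    \<open>span S\<close>, the product \<open>z \<bullet> v m\<close> is a polynomial in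
    \<open>m\<close> with nonzero coefficient at degree \<open>j\<close>; it vanishes whenever
    \<open>v m\<close> lies in \<open>span S\<close>.\<close>
  obtain y z where yz: "y \<in> span S" "\<And>w. w \<in> span S \<Longrightarrow> orthogonal z w" "b j = y + z"
    using orthogonal_subspace_decomp_exists[of S "b j"] by metis
  have "z \<noteq> 0" using yz(1,3) j(2) by auto
  then have "z \<bullet> b j \<noteq> 0" using yz by (simp add: orthogonal_def inner_add_right)
  then have fin: "finite {r :: real. (\<Sum>i\<le>n. (z \<bullet> b i) * r ^ i) = 0}"
    using j(1) by (subst polyfun_finite_roots) auto
  have "(\<Sum>i\<le>n. (z \<bullet> b i) * real m ^ i) = z \<bullet> v m" for m
    by (simp add: v_def inner_sum_right lessThan_Suc_atMost mult.commute)
  then have "real ` {m \<in> UNIV. v m \<in> span S} \<subseteq> {r. (\<Sum>i\<le>n. (z \<bullet> b i) * r ^ i) = 0}"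
    using yz(2) by (auto simp: orthogonal_def)
  then have "finite (real ` {m \<in> UNIV. v m \<in> span S})" using fin finite_subset by blast
  then show False using S(2) by (simp add: finite_image_iff)
qed

section \<open>Finiteness of the integer points and the final count\<close>

lemma finite_bounded_integer_points:
  assumes "bounded (P :: (real ^ 'e::finite) set)"
  shows "finite (P \<inter> integer_points)"
proof -
  obtain M where M: "\<And>x. x \<in> P \<Longrightarrow> norm x \<le> M" using assms by (auto simp: bounded_iff)
  let ?K = "{y \<in> \<int>. - M \<le> y \<and> y \<le> M}"
  have "finite (vec_lambda ` ((UNIV :: 'e set) \<rightarrow>\<^sub>E ?K))"
    by (intro finite_imageI finite_PiE finite_int_segment finite)
  moreover have "- M \<le> x $ e \<and> x $ e \<le> M" if "x \<in> P" for x e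
    using M[OF that] component_le_norm_cart[of x e] by linarith
  then have "x \<in> vec_lambda ` ((UNIV :: 'e set) \<rightarrow>\<^sub>E ?K)" if "x \<in> P \<inter> integer_points" for x
    using that by (intro image_eqI[of _ _ "vec_nth x"]) (auto simp: integer_points_def)
  ultimately show ?thesis by (meson finite_subset subsetI)
qed

text \<open>A cone element with positive coefficient sum \<open>k\<close> is \<open>k\<close> times
  a convex combination of points of the polytope.\<close>

lemma int_cone_base_polytope_subset:
  assumes f: "submodular f"
  defines "H \<equiv> base_polytope f \<inter> integer_points"
  shows "int_cone H \<subseteq> int_combinations (nat (aff_dim (base_polytope f) + 1)) H"
proof
  let ?t = "nat (aff_dim (base_polytope f) + 1)"
  fix w assume "w \<in> int_cone H"
  then obtain n where "w \<in> int_combinations n H" by (auto simp: int_cone_def)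
  then obtain l x where w: "w = (\<Sum>i<n. of_nat (l i) *\<^sub>R x i)" "\<forall>i<n. x i \<in> H"
    unfolding int_combinations_def by blast
  define k where "k = (\<Sum>i<n. l i)"
  show "w \<in> int_combinations ?t H"
  proof (cases "k = 0")
    case True
    then have "w = 0" using w(1) by (simp add: k_def)
    show ?thesis
    proof (cases "H = {}")
      case True
      \<comment> \<open>The empty set has affine dimension -1, so the bound is 0 and the empty sum
        represents \<open>w\<close>.\<close>
      then have "base_polytope f = {}" using base_polytope_integral[OF f] by (simp add: H_def)
      then have "?t = 0" by simp
      then show ?thesis using \<open>w = 0\<close> int_combinationsI[of 0] by simp
    next
      case False
      then show ?thesis using \<open>w = 0\<close> zero_in_int_combinations by simp
    qed
  next
    case False
    define p where "p = (\<Sum>i<n. (real (l i) / real k) *\<^sub>R x i)"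
    have "(\<Sum>i<n. real (l i) / real k) = 1"
      using False by (simp add: k_def del: sum_eq_0_iff flip: sum_divide_distrib of_nat_sum)
    then have p: "p \<in> base_polytope f"
      unfolding p_def using w(2)
      by (intro convex_sum convex_base_polytope) (auto simp: H_def)
    have kp: "real k *\<^sub>R p = w" using False by (simp add: p_def w(1) scaleR_sum_right)
    have "w $ e \<in> \<int>" for e
      unfolding w(1) sum_component using w(2)
      by (intro Ints_sum) (auto simp: H_def integer_points_def)
    then have "real k *\<^sub>R p \<in> integer_points" by (simp add: kp integer_points_def)
    moreover have "aff_dim (base_polytope f) < int ?t" by linarith
    ultimately have "real k *\<^sub>R p \<in> int_combinations ?t H"
      unfolding H_def by (intro base_polytope_int_combinations[OF f p])
    then show ?thesis by (simp add: kp)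
  qed
qed

theorem theorem3:
  fixes f :: "'e::finite set \<Rightarrow> int"
  assumes "submodular f"
  shows "int (caratheodory_rank (base_polytope f \<inter> integer_points)) \<le> aff_dim (base_polytope f) + 1 \<and>
    (0 \<notin> affine hull (base_polytope f) \<longrightarrow>
       int (caratheodory_rank (base_polytope f \<inter> integer_points)) = aff_dim (base_polytope f) + 1)"
proof -
  let ?P = "base_polytope f"
  let ?H = "?P \<inter> integer_points"
  have le: "int (caratheodory_rank ?H) \<le> aff_dim ?P + 1"
  proof -
    have "caratheodory_rank ?H \<le> nat (aff_dim ?P + 1)"
      unfolding caratheodory_rank_def by (intro Least_le int_cone_base_polytope_subset assms)
    \<comment> \<open>As \<open>aff_dim\<close> is at least -1, the conversion by \<open>nat\<close>
      loses nothing.\<close>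
    then show ?thesis using aff_dim_geq[of ?P] by linarith
  qed
  moreover have "aff_dim ?P + 1 \<le> int (caratheodory_rank ?H)" if "0 \<notin> affine hull ?P"
  proof -
    have hull: "affine hull ?H = affine hull ?P"
      using base_polytope_integral[OF assms] affine_hull_convex_hull[of ?H] by simp
    \<comment> \<open>Adjoining an origin outside the affine hull raises the affine dimension by one
      and turns it into the linear dimension of the integer points.\<close>
    then have "aff_dim ?P + 1 = aff_dim (insert 0 ?H)"
      using that aff_dim_affine_hull2[OF hull] by (simp add: aff_dim_insert)
    also have "\<dots> = int (dim ?H)" by (simp add: aff_dim_zero hull_inc dim_insert span_zero)
    finally have "aff_dim ?P + 1 = int (dim ?H)" .
    moreover obtain B where B: "B \<subseteq> ?H" "independent B" "card B = dim ?H"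
      using basis_exists[of ?H] by metis
    \<comment> \<open>The upper bound supplies an admissible number, so the least one is
      attained.\<close>
    moreover have "int_cone ?H \<subseteq> int_combinations (caratheodory_rank ?H) ?H"
      unfolding caratheodory_rank_def by (rule LeastI, rule int_cone_base_polytope_subset[OF assms])
    then have "card B \<le> caratheodory_rank ?H"
      using B finite_bounded_integer_points[OF compact_imp_bounded[OF compact_base_polytope]]
      by (intro independent_card_le[of ?H]) auto
    ultimately show ?thesis by simp
  qed
  ultimately show ?thesis by auto
qed

end
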